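(* In the setting described in the context, suppose: (i) (Occupancy coverage and temporal consistency) for every $t\ge t_0$, $s\in[0,T]$ and $j=1,\dots,M(t)$, $$\mathcal O^{(j)}(P(x(t)),t)\oplus \mathcal B(\bar v_{o}s+r_{\rm col})\subseteq \widehat{\mathcal H}^{(j)}(t,s),$$ and for every update interval $[t_k,t_{k+1})$, every $j$, and every $\delta\ge 0$ with $t,t+\delta\in[t_k,t_{k+1})$ and $s,s+\delta\in[0,T]$, $\widehat{\mathcal H}^{(j)}(t+\delta,s)\subseteq\widehat{\mathcal H}^{(j)}(t,s+\delta)$; (ii) (Verified terminal set) there is an extended class-$\mathcal K$ function $\alpha_S$ such that for every $q\ge t_0+T$, every $y\in\mathcal S_0(q)$ and every $j$, $$\frac{\partial h_j^S}{\partial q}(y,q)+\nabla_y h_j^S(y,q)^\top f_b(y)\ \ge\ -\alpha_S\big(h_j^S(y,q)\big),$$ and this $\alpha_S$ is the one used in the OCBF-QP; (iii) on each update interval the occupancy margins satisfy $\dfrac{\partial h_j^C}{\partial t}(y,t,s)-\dfrac{\partial h_j^C}{\partial s}(y,t,s)\ge 0$ for all $y\in\mathcal X$, $s\in[0,T]$ and all $j$; (iv) $f$, $g$, $P$, $\pi_b$, $h_j^C$, $h_j^S$ are continuously differentiable between updates, $\pi_b(x)\in\mathcal U$ for all $x\in\mathcal X$, and the backup flow $\varphi_b(x,\cdot)$ exists over $[0,T]$. Then for every time $t$ between updates and every $x\in\mathcal S(t)$, the backup input $u=\pi_b(x)$ satisfies all constraints of the OCBF-QP at $(x,t)$. Consequently,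 the OCBF-QP is feasible at every state in $\mathcal S(t)$.
   Context: **Robot.** $\dot x=f(x)+g(x)u$, $x\in\mathcal X\subseteq\mathbb R^n$, $u\in\mathcal U\subset\mathbb R^m$, with $\mathcal X,\mathcal U$ compact and convex and $f,g$ continuously differentiable and locally Lipschitz. All trajectories, including backup trajectories, take values in $\mathcal X$. $P:\mathcal X\to\mathcal W\subseteq\mathbb R^d$ is continuously differentiable and gives the workspace position of the robot. $u_{\rm nom}:\mathcal X\times\mathbb R_{\ge0}\to\mathcal U$ is a given nominal controller. Continuous differentiability on a non-open set means existence of a $C^1$ extension to a neighbourhood; time derivatives at interval endpoints are one-sided. **Constants and conventions.** Horizon $T>0$, obstacle speed bound $\bar v_o>0$, collision radius $r_{\rm col}\ge0$, terminal clearance $\rho_T\ge0$, matrix $W\succ0$, $\|v\|_W^2=v^\top Wv$. $\mathcal B(r)\subseteq\mathbb R^d$ is the closed Euclidean ball of radius $r$ centred at $0$, and $\oplus$ is the Minkowski sum. An extended class-$\mathcal K$ function is a continuous strictly increasing $\alpha:\mathbb R\to\mathbb R$ with $\alpha(0)=0$. $\alpha_C$ is a locally Lipschitz extended class-$\mathcal K$ function. **Updates.** $0\le t_0<t_1<\cdots$ are update times whose intervals $[t_k,t_{k+1})$ partition $[t_0,\infty)$. On each update interval the number of occluded regions $M=M(t)\ge1$, their indexing $j=1,\dots,M$, and the backup policy $\pi_b$ are fixed; all data may change discontinuously at the $t_k$. "Between updates" means within one such interval, and quantifiers over $j$ range over $j=1,\dots,M$. **Occupancy.** $\mathcal O(P(x(t)),t)=\bigcup_{j=1}^{M(t)}\mathcal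 O^{(j)}(P(x(t)),t)\subseteq\mathcal W$ is the set of positions at which an undetected obstacle may be located at time $t$, where $x(t)$ is the realized robot state. $\widehat{\mathcal H}^{(j)}(t,s)\subseteq\mathbb R^d$, $s\in[0,T]$, are the predicted collision-inflated reachable-occupancy sets. The occupancy margins $h_j^C(y,t,s)\in\mathbb R$ ($y\in\mathcal X$, $s\in[0,T]$) satisfy: $h_j^C(y,t,s)\ge0\Rightarrow P(y)\notin\operatorname{int}\widehat{\mathcal H}^{(j)}(t,s)$. **Backup flow.** $\pi_b:\mathcal X\to\mathcal U$ is a state-feedback law, $f_b(x)=f(x)+g(x)\pi_b(x)$, and $\varphi_b(x,s)$ solves $\frac{d}{ds}\varphi_b(x,s)=f_b(\varphi_b(x,s))$, $\varphi_b(x,0)=x$. Its sensitivity is $\Phi_b(x,s)=\partial\varphi_b(x,s)/\partial x$. **Terminal barriers.** $h_j^S(y,q)\in\mathbb R$ ($y\in\mathcal X$) satisfy: $h_j^S(y,q)\ge0\Rightarrow h_j^C(y,q-T,T)\ge\rho_T$. The terminal set is $\mathcal S_0(q)=\{y\in\mathcal X: h_j^S(y,q)\ge0,\ j=1,\dots,M\}$. For argument $q$, the data ($M$, $\pi_b$, $f_b$, $h_j^C,h_j^S$) are those of the update interval containing $q-T$. Set $\eta_j(x,t)=h_j^S(\varphi_b(x,T),t+T)$. **Recoverable set.** $$\mathcal S(t)=\{x\in\mathcal X:\ h_j^C(\varphi_b(x,s),t,s)\ge0\ \ \forall s\in[0,T],\ \forall j;\ \ \eta_j(x,t)\ge0\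 \ \forall j\}.$$ **OCBF-QP.** For $\tau\in[t,t+T]$ put $s=\tau-t$, $y=\varphi_b(x,s)$, $\xi_j^C(x,t;\tau)=h_j^C(y,t,s)$, and define $$A_j^C=(\nabla_yh_j^C)^\top\Phi_b(x,s)g(x),\qquad c_j^C=(\nabla_yh_j^C)^\top[\Phi_b(x,s)f(x)-f_b(y)]+\tfrac{\partial h_j^C}{\partial t}-\tfrac{\partial h_j^C}{\partial s},$$ with $h_j^C$ derivatives evaluated at $(y,t,s)$, and $$A_j^S=(\nabla_yh_j^S)^\top\Phi_b(x,T)g(x),\qquad c_j^S=(\nabla_yh_j^S)^\top\Phi_b(x,T)f(x)+\tfrac{\partial h_j^S}{\partial q},$$ with $h_j^S$ derivatives evaluated at $(\varphi_b(x,T),t+T)$. The OCBF-QP at $(x,t)$ is: minimize $\frac12\|u-u_{\rm nom}(x,t)\|_W^2$ over $u\in\mathcal U$ subject to $$c_j^C+A_j^Cu\ge-\alpha_C(\xi_j^C)\quad\forall j,\ \forall\tau\in[t,t+T],\qquad c_j^S+A_j^Su\ge-\alpha_S(\eta_j)\quad\forall j.$$ It is feasible at $(x,t)$ if some $u\in\mathcal U$ satisfies all these constraints. *)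

theory Defs
  imports "HOL-Analysis.Analysis" "HOL-Library.Set_Algebras"
begin

text \<open>Continuous differentiability on a not necessarily open set: there is a \<open>C\<^sup>1\<close> extension
  to an open neighbourhood.\<close>

definition C1_on :: "('a::real_normed_vector \<Rightarrow> 'b::real_normed_vector) \<Rightarrow> 'a set \<Rightarrow> bool" where
  "C1_on f S \<longleftrightarrow>
     (\<exists>V F. \<exists>F' :: 'a \<Rightarrow> 'a \<Rightarrow>\<^sub>L 'b. open V \<and> S \<subseteq> V \<and> (\<forall>x\<in>S. F x = f x) \<and>
        (\<forall>x\<in>V. (F has_derivative blinfun_apply (F' x)) (at x)) \<and> continuous_on V F')"

definition ext_class_K :: "(real \<Rightarrow> real) \<Rightarrow> bool" where
  "ext_class_K \<alpha> \<longleftrightarrow> continuous_on UNIV \<alpha> \<and> strict_mono \<alpha> \<and> \<alpha> 0 = 0"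

definition pos_def_matrix :: "real^'m^'m \<Rightarrow> bool" where
  "pos_def_matrix A \<longleftrightarrow> transpose A = A \<and> (\<forall>v. v \<noteq> 0 \<longrightarrow> v \<bullet> (A *v v) > 0)"

text \<open>Spatial derivatives of functions that are only given on the compact convex state set \<open>S\<close>
  are taken relative to \<open>S\<close>. If \<open>S\<close> has nonempty interior, they are unique and equal
  to the derivatives of any \<open>C\<^sup>1\<close> extension. If \<open>S\<close> has empty interior, they are unique
  only along directions tangent to \<open>S\<close>, and some representative is chosen.\<close>

definition gradient_within :: "(real^'n \<Rightarrow> real) \<Rightarrow> (real^'n) set \<Rightarrow> real^'n \<Rightarrow> real^'n" where
  "gradient_within h S y = (SOME v. (h has_derivative (\<lambda>w. v \<bullet> w)) (at y within S))"

definition jacobian_within ::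
    "(real^'n \<Rightarrow> real^'k) \<Rightarrow> (real^'n) set \<Rightarrow> real^'n \<Rightarrow> real^'n^'k" where
  "jacobian_within F S x = matrix (frechet_derivative F (at x within S))"

text \<open>The data that are fixed on an update interval (number of regions, backup policy and its
  flow) are indexed by the number \<open>k\<close> of the interval. The regions are numbered from
  \<open>1\<close>. The margin \<open>margin D j y t s\<close> and the terminal barrier \<open>barrier D j y q\<close> carry the
  interval implicitly: it is the one containing \<open>t\<close>, respectively \<open>q - horizon D\<close>.
  Functions on subsets are total functions whose values outside are irrelevant.\<close>

record ('n::finite, 'm::finite, 'd::finite) ocbf =
  states :: "(real^'n) set"
  inputs :: "(real^'m) set"
  workspace :: "(real^'d) set"
  drift :: "real^'n \<Rightarrow> real^'n"
  actuation :: "real^'n \<Rightarrow> real^'m^'n"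
  position :: "real^'n \<Rightarrow> real^'d"
  u_nom :: "real^'n \<Rightarrow> real \<Rightarrow> real^'m"
  traj :: "real \<Rightarrow> real^'n"
  horizon :: real
  obs_speed :: real
  col_radius :: real
  term_clearance :: real
  weight :: "real^'m^'m"
  alpha_C :: "real \<Rightarrow> real"
  upd :: "nat \<Rightarrow> real"
  regions :: "nat \<Rightarrow> nat"
  occ :: "nat \<Rightarrow> real^'d \<Rightarrow> real \<Rightarrow> (real^'d) set"
  pred_occ :: "nat \<Rightarrow> real \<Rightarrow> real \<Rightarrow> (real^'d) set"
  margin :: "nat \<Rightarrow> real^'n \<Rightarrow> real \<Rightarrow> real \<Rightarrow> real"
  policy :: "nat \<Rightarrow> real^'n \<Rightarrow> real^'m"
  flow :: "nat \<Rightarrow> real^'n \<Rightarrow> real \<Rightarrow> real^'n"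
  barrier :: "nat \<Rightarrow> real^'n \<Rightarrow> real \<Rightarrow> real"

definition upd_interval :: "('n::finite, 'm::finite, 'd::finite) ocbf \<Rightarrow> nat \<Rightarrow> real set" where
  "upd_interval D k = {upd D k ..< upd D (Suc k)}"

text \<open>The arguments \<open>q\<close> of the terminal barriers that belong to update interval \<open>k\<close>.\<close>

definition shifted_interval :: "('n::finite, 'm::finite, 'd::finite) ocbf \<Rightarrow> nat \<Rightarrow> real set" where
  "shifted_interval D k = {q. q - horizon D \<in> upd_interval D k}"

definition backup_field ::
    "('n::finite, 'm::finite, 'd::finite) ocbf \<Rightarrow> nat \<Rightarrow> real^'n \<Rightarrow> real^'n" where
  "backup_field D k x = drift D x + actuation D x *v policy D k x"

definition is_backup_flow :: "('n::finite, 'm::finite, 'd::finite) ocbf \<Rightarrow> nat \<Rightarrow> bool" where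
  "is_backup_flow D k \<longleftrightarrow>
     (\<forall>x\<in>states D. flow D k x 0 = x \<and>
        (\<forall>s\<in>{0..horizon D}. flow D k x s \<in> states D \<and>
           (flow D k x has_vector_derivative backup_field D k (flow D k x s))
             (at s within {0..horizon D})))"

text \<open>The realized trajectory is only required to be a solution in the integral
  (Caratheodory) sense, so that no regularity of the applied input is imposed.\<close>

definition is_robot_traj :: "('n::finite, 'm::finite, 'd::finite) ocbf \<Rightarrow> bool" where
  "is_robot_traj D \<longleftrightarrow>
     (\<forall>t\<ge>upd D 0. traj D t \<in> states D) \<and>
     (\<exists>u. (\<forall>t\<ge>upd D 0. u t \<in> inputs D) \<and>
        (\<forall>t\<ge>upd D 0.
           ((\<lambda>r. drift D (traj D r) + actuation D (traj D r) *v u r)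
              has_integral (traj D t - traj D (upd D 0))) {upd D 0..t}))"

definition ocbf_setting :: "('n::finite, 'm::finite, 'd::finite) ocbf \<Rightarrow> bool" where
  "ocbf_setting D \<longleftrightarrow>
     compact (states D) \<and> convex (states D) \<and> compact (inputs D) \<and> convex (inputs D) \<and>
     local_lipschitz (UNIV :: real set) (states D) (\<lambda>_. drift D) \<and>
     local_lipschitz (UNIV :: real set) (states D) (\<lambda>_. actuation D) \<and>
     position D ` states D \<subseteq> workspace D \<and>
     (\<forall>x\<in>states D. \<forall>t\<ge>0. u_nom D x t \<in> inputs D) \<and>
     horizon D > 0 \<and> obs_speed D > 0 \<and> col_radius D \<ge> 0 \<and> term_clearance D \<ge> 0 \<and>
     pos_def_matrix (weight D) \<and>
     ext_class_K (alpha_C D) \<and> local_lipschitz (UNIV :: real set) UNIV (\<lambda>_. alpha_C D) \<and>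
     0 \<le> upd D 0 \<and> strict_mono (upd D) \<and> (\<Union>k. upd_interval D k) = {upd D 0..} \<and>
     (\<forall>k. regions D k \<ge> 1) \<and>
     is_robot_traj D \<and>
     (\<forall>k. \<forall>t\<in>upd_interval D k.
        (\<Union>j\<in>{1..regions D k}. occ D j (position D (traj D t)) t) \<subseteq> workspace D) \<and>
     (\<forall>k. \<forall>t\<in>upd_interval D k. \<forall>j\<in>{1..regions D k}. \<forall>y\<in>states D. \<forall>s\<in>{0..horizon D}.
        margin D j y t s \<ge> 0 \<longrightarrow> position D y \<notin> interior (pred_occ D j t s)) \<and>
     (\<forall>k. \<forall>q\<in>shifted_interval D k. \<forall>j\<in>{1..regions D k}. \<forall>y\<in>states D.
        barrier D j y q \<ge> 0 \<longrightarrow>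
        margin D j y (q - horizon D) (horizon D) \<ge> term_clearance D)"

definition margin_dy :: "('n::finite, 'm::finite, 'd::finite) ocbf \<Rightarrow>
    nat \<Rightarrow> real^'n \<Rightarrow> real \<Rightarrow> real \<Rightarrow> real^'n" where
  "margin_dy D j y t s = gradient_within (\<lambda>z. margin D j z t s) (states D) y"

text \<open>Time derivatives are relative to the update interval, hence one-sided at its left end;
  similarly for the prediction time at \<open>0\<close> and \<open>horizon D\<close>.\<close>

definition margin_dt :: "('n::finite, 'm::finite, 'd::finite) ocbf \<Rightarrow>
    nat \<Rightarrow> nat \<Rightarrow> real^'n \<Rightarrow> real \<Rightarrow> real \<Rightarrow> real" where
  "margin_dt D k j y t s =
     vector_derivative (\<lambda>t'. margin D j y t' s) (at t within upd_interval D k)"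

definition margin_ds :: "('n::finite, 'm::finite, 'd::finite) ocbf \<Rightarrow>
    nat \<Rightarrow> real^'n \<Rightarrow> real \<Rightarrow> real \<Rightarrow> real" where
  "margin_ds D j y t s =
     vector_derivative (\<lambda>s'. margin D j y t s') (at s within {0..horizon D})"

definition barrier_dy :: "('n::finite, 'm::finite, 'd::finite) ocbf \<Rightarrow>
    nat \<Rightarrow> real^'n \<Rightarrow> real \<Rightarrow> real^'n" where
  "barrier_dy D j y q = gradient_within (\<lambda>z. barrier D j z q) (states D) y"

definition barrier_dq :: "('n::finite, 'm::finite, 'd::finite) ocbf \<Rightarrow>
    nat \<Rightarrow> nat \<Rightarrow> real^'n \<Rightarrow> real \<Rightarrow> real" where
  "barrier_dq D k j y q =
     vector_derivative (\<lambda>q'. barrier D j y q') (at q within shifted_interval D k)"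

definition sensitivity :: "('n::finite, 'm::finite, 'd::finite) ocbf \<Rightarrow>
    nat \<Rightarrow> real^'n \<Rightarrow> real \<Rightarrow> real^'n^'n" where
  "sensitivity D k x s = jacobian_within (\<lambda>z. flow D k z s) (states D) x"

definition terminal_set :: "('n::finite, 'm::finite, 'd::finite) ocbf \<Rightarrow>
    nat \<Rightarrow> real \<Rightarrow> (real^'n) set" where
  "terminal_set D k q = {y \<in> states D. \<forall>j\<in>{1..regions D k}. barrier D j y q \<ge> 0}"

definition terminal_value :: "('n::finite, 'm::finite, 'd::finite) ocbf \<Rightarrow>
    nat \<Rightarrow> nat \<Rightarrow> real^'n \<Rightarrow> real \<Rightarrow> real" where
  "terminal_value D k j x t = barrier D j (flow D k x (horizon D)) (t + horizon D)"

definition recoverable_set :: "('n::finite, 'm::finite, 'd::finite) ocbf \<Rightarrow>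
    nat \<Rightarrow> real \<Rightarrow> (real^'n) set" where
  "recoverable_set D k t =
     {x \<in> states D.
        (\<forall>s\<in>{0..horizon D}. \<forall>j\<in>{1..regions D k}. margin D j (flow D k x s) t s \<ge> 0) \<and>
        (\<forall>j\<in>{1..regions D k}. terminal_value D k j x t \<ge> 0)}"

definition A_C :: "('n::finite, 'm::finite, 'd::finite) ocbf \<Rightarrow>
    nat \<Rightarrow> nat \<Rightarrow> real^'n \<Rightarrow> real \<Rightarrow> real \<Rightarrow> real^'m" where
  "A_C D k j x t s =
     margin_dy D j (flow D k x s) t s v* (sensitivity D k x s ** actuation D x)"

definition c_C :: "('n::finite, 'm::finite, 'd::finite) ocbf \<Rightarrow>
    nat \<Rightarrow> nat \<Rightarrow> real^'n \<Rightarrow> real \<Rightarrow> real \<Rightarrow> real" where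
  "c_C D k j x t s =
     (let y = flow D k x s in
        margin_dy D j y t s \<bullet> (sensitivity D k x s *v drift D x - backup_field D k y)
        + margin_dt D k j y t s - margin_ds D j y t s)"

definition A_S :: "('n::finite, 'm::finite, 'd::finite) ocbf \<Rightarrow>
    nat \<Rightarrow> nat \<Rightarrow> real^'n \<Rightarrow> real \<Rightarrow> real^'m" where
  "A_S D k j x t =
     barrier_dy D j (flow D k x (horizon D)) (t + horizon D)
       v* (sensitivity D k x (horizon D) ** actuation D x)"

definition c_S :: "('n::finite, 'm::finite, 'd::finite) ocbf \<Rightarrow>
    nat \<Rightarrow> nat \<Rightarrow> real^'n \<Rightarrow> real \<Rightarrow> real" where
  "c_S D k j x t =
     (let y = flow D k x (horizon D); q = t + horizon D in
        barrier_dy D j y q \<bullet> (sensitivity D k x (horizon D) *v drift D x)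
        + barrier_dq D k j y q)"

definition qp_cost :: "('n::finite, 'm::finite, 'd::finite) ocbf \<Rightarrow>
    real^'n \<Rightarrow> real \<Rightarrow> real^'m \<Rightarrow> real" where
  "qp_cost D x t u = (let v = u - u_nom D x t in (v \<bullet> (weight D *v v)) / 2)"

definition qp_feasible_set :: "('n::finite, 'm::finite, 'd::finite) ocbf \<Rightarrow>
    (real \<Rightarrow> real) \<Rightarrow> nat \<Rightarrow> real^'n \<Rightarrow> real \<Rightarrow> (real^'m) set" where
  "qp_feasible_set D \<alpha>\<^sub>S k x t =
     {u \<in> inputs D.
        (\<forall>j\<in>{1..regions D k}. \<forall>\<tau>\<in>{t..t + horizon D}.
           c_C D k j x t (\<tau> - t) + A_C D k j x t (\<tau> - t) \<bullet> u
             \<ge> - alpha_C D (margin D j (flow D k x (\<tau> - t)) t (\<tau> - t))) \<and>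
        (\<forall>j\<in>{1..regions D k}.
           c_S D k j x t + A_S D k j x t \<bullet> u \<ge> - \<alpha>\<^sub>S (terminal_value D k j x t))}"

text \<open>An optimization problem is a cost function together with the set of admissible points.\<close>

definition ocbf_qp :: "('n::finite, 'm::finite, 'd::finite) ocbf \<Rightarrow>
    (real \<Rightarrow> real) \<Rightarrow> nat \<Rightarrow> real^'n \<Rightarrow> real \<Rightarrow> (real^'m \<Rightarrow> real) \<times> (real^'m) set" where
  "ocbf_qp D \<alpha>\<^sub>S k x t = (qp_cost D x t, qp_feasible_set D \<alpha>\<^sub>S k x t)"

definition satisfies_constraints :: "'u \<Rightarrow> ('u \<Rightarrow> real) \<times> 'u set \<Rightarrow> bool" where
  "satisfies_constraints u p \<longleftrightarrow> u \<in> snd p"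

definition feasible :: "('u \<Rightarrow> real) \<times> 'u set \<Rightarrow> bool" where
  "feasible p \<longleftrightarrow> (\<exists>u. satisfies_constraints u p)"

end

theory Submission
  imports Defs
begin

text \<open>Inserting \<open>u = \<pi>\<^sub>b(x)\<close> turns both constraints into expressions in \<open>\<Phi>\<^sub>b(x,s) f\<^sub>b(x)\<close>, which equals
  \<open>f\<^sub>b(\<phi>\<^sub>b(x,s))\<close>: both are the derivative at \<open>r = 0\<close> of \<open>\<phi>\<^sub>b(\<phi>\<^sub>b(x,r),s) = \<phi>\<^sub>b(\<phi>\<^sub>b(x,s),r)\<close>. The
  remaining terms are nonnegative by the temporal monotonicity of the margins, or bounded below by
  the terminal set condition. The analytic content is that \<open>\<phi>\<^sub>b(\<sqdot>,s)\<close> is differentiable relative to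
  the compact convex state set, with the variational equation providing the derivative.\<close>

section \<open>Growth estimate and linear differential equations\<close>

text \<open>The squared norm, unlike the norm, is differentiable at zeros of \<open>w\<close>.
  Weighted by \<open>exp (- (2 * L * r))\<close> it is nonincreasing by Cauchy-Schwarz.\<close>

lemma gronwall_norm:
  fixes w :: "real \<Rightarrow> 'a::real_inner"
  assumes deriv: "\<And>s. s \<in> {0..T} \<Longrightarrow> (w has_vector_derivative w' s) (at s within {0..T})"
    and bound: "\<And>s. s \<in> {0..T} \<Longrightarrow> norm (w' s) \<le> L * norm (w s)"
    and s: "s \<in> {0..T}"
  shows "norm (w s) \<le> exp (L * s) * norm (w 0)"
proof -
  define p where "p r = exp (- (2 * L * r)) * (w r \<bullet> w r)" for r
  have cont: "continuous_on {0..T} w"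
    by (rule has_derivative_continuous_on[OF deriv[unfolded has_vector_derivative_def]])
  have "p s \<le> p 0"
  proof (rule DERIV_nonpos_imp_decreasing_open[of 0 s p])
    show "0 \<le> s" using s by simp
    show "continuous_on {0..s} p"
      unfolding p_def using s by (intro continuous_intros continuous_on_subset[OF cont]) auto
    fix r assume r: "0 < r" "r < s"
    then have rT: "r \<in> {0..T}" using s by simp
    have "at r within {0..T} = at r"
      by (rule at_within_interior) (use r s in auto)
    then have dw: "(w has_derivative (\<lambda>h. h *\<^sub>R w' r)) (at r)"
      using deriv[OF rT] by (simp add: has_vector_derivative_def)
    have "(p has_real_derivative exp (- (2 * L * r)) * (2 * (w r \<bullet> w' r - L * (w r \<bullet> w r)))) (at r)"
      unfolding p_def has_field_derivative_def
      by (rule derivative_eq_intros dw refl | rule ext)+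
        (simp add: algebra_simps inner_commute)
    moreover have "w r \<bullet> w' r \<le> L * (w r \<bullet> w r)"
    proof -
      have "w r \<bullet> w' r \<le> norm (w r) * norm (w' r)" by (rule norm_cauchy_schwarz)
      also have "\<dots> \<le> norm (w r) * (L * norm (w r))"
        by (rule mult_left_mono[OF bound[OF rT]]) simp
      finally show ?thesis by (simp add: dot_square_norm power2_eq_square mult_ac)
    qed
    ultimately show "\<exists>y. (p has_real_derivative y) (at r) \<and> y \<le> 0"
      by (intro exI conjI) (assumption, simp add: mult_le_0_iff)
  qed
  then have "(norm (w s))\<^sup>2 \<le> exp (2 * L * s) * (norm (w 0))\<^sup>2"
    by (simp add: p_def dot_square_norm exp_minus field_simps)
  also have "\<dots> = (exp (L * s) * norm (w 0))\<^sup>2"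
    by (simp add: power_mult_distrib mult_ac flip: exp_of_nat_mult)
  finally show ?thesis
    by (rule power2_le_imp_le) simp
qed

text \<open>With \<open>A\<close> taken along a trajectory this is the variational equation, whose
  solution is the candidate for the derivative of the flow in the initial state. It comes from a
  fixed point of the integral equation.\<close>

lemma linear_ode_solution_exists:
  fixes A :: "real \<Rightarrow> 'a::banach \<Rightarrow>\<^sub>L 'a"
  assumes cont: "continuous_on {0..T} A" and T: "T > 0"
  obtains M where "M 0 = id_blinfun"
    and "\<And>s. s \<in> {0..T} \<Longrightarrow> (M has_vector_derivative A s o\<^sub>L M s) (at s within {0..T})"
proof -
  obtain B0 where B0: "\<And>s. s \<in> {0..T} \<Longrightarrow> norm (A s) \<le> B0"
    using compact_imp_bounded[OF compact_continuous_image[OF cont compact_Icc]]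
    by (force simp: bounded_iff)
  define B where "B = max B0 0 + 1"
  have B: "B > 0" "\<And>s. s \<in> {0..T} \<Longrightarrow> norm (A s) \<le> B"
    using B0 unfolding B_def by (force, fastforce)
  \<comment> \<open>Picard iteration for \<open>exp (- K s) M s\<close>: the weight makes it a contraction on all of \<open>[0, T]\<close>.\<close>
  define K where "K = 2 * B"
  have K: "K > 0" using B by (simp add: K_def)
  \<comment> \<open>Bounded continuous functions live on the whole real line, so time is clamped to
    \<open>{0..T}\<close>.\<close>
  define c where "c s = max 0 (min s T)" for s :: real
  have c: "c s \<in> {0..T}" for s using T by (auto simp: c_def)
  have c_id: "c s = s" if "s \<in> {0..T}" for s using that by (auto simp: c_def)
  \<comment> \<open>\<open>N r\<close> stands for \<open>exp (- (K * r)) *\<^sub>R M r\<close>, so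
    \<open>G N r\<close> is the right-hand side \<open>A r o\<^sub>L M r\<close>.\<close>
  define G where "G N r = exp (K * r) *\<^sub>R (A r o\<^sub>L apply_bcontfun N r)"
    for N :: "real \<Rightarrow>\<^sub>C ('a \<Rightarrow>\<^sub>L 'a)" and r
  define F where "F N s = exp (- (K * c s)) *\<^sub>R (id_blinfun + integral {0..c s} (G N))"
    for N s
  have contG: "continuous_on {0..T} (G N)" for N
    unfolding G_def by (intro continuous_intros cont continuous_on_apply_bcontfun)
  have intG: "G N integrable_on {0..s}" if "s \<in> {0..T}" for N s
    by (rule integrable_continuous_real, rule continuous_on_subset[OF contG]) (use that in auto)
  have F_bcontfun: "F N \<in> bcontfun" for N
  proof -
    define H where "H s = exp (- (K * s)) *\<^sub>R (id_blinfun + integral {0..s} (G N))" for s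
    have H: "continuous_on {0..T} H"
      unfolding H_def
      by (intro continuous_intros indefinite_integral_continuous_1 integrable_continuous_real contG)
    have F_eq: "F N = H \<circ> c" by (auto simp: F_def H_def)
    have "continuous_on UNIV c" unfolding c_def by (intro continuous_intros)
    then have "continuous_on UNIV (H \<circ> c)"
      by (rule continuous_on_compose) (rule continuous_on_subset[OF H], use c in auto)
    moreover have "bounded (range (H \<circ> c))"
      by (rule bounded_subset[OF compact_imp_bounded[OF compact_continuous_image[OF H compact_Icc]]])
        (use c in auto)
    ultimately show ?thesis by (simp add: bcontfun_def F_eq)
  qed
  define P where "P N = Bcontfun (F N)" for N
  have P: "apply_bcontfun (P N) = F N" for N
    unfolding P_def by (rule Bcontfun_inverse[OF F_bcontfun])
  have "dist (P N1) (P N2) \<le> 1/2 * dist N1 N2" for N1 N2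
  proof (rule dist_bound, unfold P)
    fix s
    define d where "d = dist N1 N2"
    have cs: "c s \<in> {0..T}" "0 \<le> c s" using c[of s] by auto
    have "((\<lambda>r. exp (K * r)) has_integral (exp (K * c s) / K - exp (K * 0) / K)) {0..c s}"
      by (rule fundamental_theorem_of_calculus[OF cs(2)])
        (auto intro!: derivative_eq_intros simp: K less_imp_neq[OF K, symmetric]
            simp flip: has_real_derivative_iff_has_vector_derivative)
    then have ie: "((\<lambda>r. B * d * exp (K * r)) has_integral B * d * (exp (K * c s) / K - 1 / K)) {0..c s}"
      using has_integral_mult_right[of "\<lambda>r. exp (K * r)" _ _ "B * d"] by simp
    have "norm (integral {0..c s} (\<lambda>r. G N1 r - G N2 r)) \<le> integral {0..c s} (\<lambda>r. B * d * exp (K * r))"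
    proof (rule integral_norm_bound_integral)
      show "(\<lambda>r. G N1 r - G N2 r) integrable_on {0..c s}"
        by (intro integrable_diff intG cs)
      show "(\<lambda>r. B * d * exp (K * r)) integrable_on {0..c s}" using ie by blast
      fix r assume "r \<in> {0..c s}"
      then have r: "r \<in> {0..T}" using cs by auto
      have "norm (A r o\<^sub>L (N1 r - N2 r)) \<le> norm (A r) * norm (apply_bcontfun N1 r - N2 r)"
        by (rule norm_blinfun_compose)
      also have "\<dots> \<le> B * d"
        unfolding d_def using B(2)[OF r] dist_bounded[of N1 r N2] B(1)
        by (intro mult_mono) (auto simp: dist_norm)
      finally have "exp (K * r) * norm (A r o\<^sub>L (N1 r - N2 r)) \<le> exp (K * r) * (B * d)"
        by (intro mult_left_mono) auto
      then show "norm (G N1 r - G N2 r) \<le> B * d * exp (K * r)"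
        by (simp add: G_def bounded_bilinear.diff_right[OF bounded_bilinear_blinfun_compose] mult_ac flip: scaleR_diff_right)
    qed
    \<comment> \<open>The contraction factor is \<open>B / K\<close>, which is one half by the
      choice of \<open>K\<close>.\<close>
    also have "\<dots> = d / 2 * (exp (K * c s) - 1)"
      unfolding integral_unique[OF ie] using B(1) by (simp add: K_def field_simps)
    also have "\<dots> \<le> d / 2 * exp (K * c s)"
      by (rule mult_left_mono) (simp_all add: d_def)
    finally have *: "exp (- (K * c s)) * norm (integral {0..c s} (\<lambda>r. G N1 r - G N2 r))
        \<le> exp (- (K * c s)) * (d / 2 * exp (K * c s))"
      by (rule mult_left_mono) simp
    have "F N1 s - F N2 s = exp (- (K * c s)) *\<^sub>R integral {0..c s} (\<lambda>r. G N1 r - G N2 r)"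
      by (simp add: F_def integral_diff[OF intG[OF cs(1)] intG[OF cs(1)]] flip: scaleR_diff_right)
    then show "dist (F N1 s) (F N2 s) \<le> 1/2 * dist N1 N2"
      using * by (simp add: dist_norm d_def exp_minus field_simps)
  qed
  then obtain N where N: "P N = N"
    using banach_fix_type[of "1/2" P] by auto
  define M where "M s = exp (K * s) *\<^sub>R apply_bcontfun N s" for s
  have M_eq: "M s = id_blinfun + integral {0..s} (G N)" if "s \<in> {0..T}" for s
  proof -
    have "apply_bcontfun N s = F N s" using P[of N] N by simp
    then show ?thesis by (simp add: M_def F_def c_id[OF that] exp_minus)
  qed
  show thesis
  proof
    show "M 0 = id_blinfun" using M_eq[of 0] T by simp
    fix s assume s: "s \<in> {0..T}"
    have "((\<lambda>s. id_blinfun + integral {0..s} (G N)) has_vector_derivative 0 + G N s) (at s within {0..T})"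
      by (intro has_vector_derivative_add has_vector_derivative_const
          integral_has_vector_derivative contG s)
    moreover have "G N s = A s o\<^sub>L M s"
      by (simp add: G_def M_def bounded_bilinear.scaleR_right[OF bounded_bilinear_blinfun_compose])
    ultimately show "(M has_vector_derivative A s o\<^sub>L M s) (at s within {0..T})"
      using M_eq s by (auto intro: has_vector_derivative_transform)
  qed
qed

section \<open>Semiflow of a continuously differentiable field on a compact convex set\<close>

text \<open>\<open>A\<close> is one continuous choice of derivative relative to \<open>S\<close>,
  which may have empty interior. Regularity of the flow in the initial state is derived, not
  assumed.\<close>

locale compact_semiflow =
  fixes S :: "'a::euclidean_space set" and v :: "'a \<Rightarrow> 'a" and A :: "'a \<Rightarrow> 'a \<Rightarrow>\<^sub>L 'a"
    and \<phi> :: "'a \<Rightarrow> real \<Rightarrow> 'a" and T :: real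
  assumes compact: "compact S" and convex: "convex S" and T: "T > 0"
    and v_deriv: "\<And>x. x \<in> S \<Longrightarrow> (v has_derivative A x) (at x within S)"
    and A_cont: "continuous_on S A"
    and flow_0: "\<And>x. x \<in> S \<Longrightarrow> \<phi> x 0 = x"
    and flow_in: "\<And>x s. x \<in> S \<Longrightarrow> s \<in> {0..T} \<Longrightarrow> \<phi> x s \<in> S"
    and flow_deriv: "\<And>x s. x \<in> S \<Longrightarrow> s \<in> {0..T} \<Longrightarrow>
      (\<phi> x has_vector_derivative v (\<phi> x s)) (at s within {0..T})"
begin

definition B :: real where
  "B = (SOME b. b > 0 \<and> (\<forall>x\<in>S. norm (A x) \<le> b))"

lemma B: "B > 0" "x \<in> S \<Longrightarrow> norm (A x) \<le> B"
proof -
  have "bounded (A ` S)"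
    by (rule compact_imp_bounded[OF compact_continuous_image[OF A_cont compact]])
  then have "\<exists>b>0. \<forall>x\<in>S. norm (A x) \<le> b"
    by (auto simp: bounded_pos)
  from someI_ex[OF this] show "B > 0" "x \<in> S \<Longrightarrow> norm (A x) \<le> B"
    by (auto simp: B_def)
qed

lemma v_lipschitz: "x \<in> S \<Longrightarrow> y \<in> S \<Longrightarrow> norm (v x - v y) \<le> B * norm (x - y)"
  by (rule differentiable_bound[OF convex v_deriv]) (auto simp: B simp flip: norm_blinfun.rep_eq)

text \<open>Stated for arbitrary solution curves, so that it yields both continuous dependence on
  the initial state and, for equal initial values, uniqueness.\<close>

lemma solutions_lipschitz:
  assumes "\<And>s. s \<in> {0..\<tau>} \<Longrightarrow> p s \<in> S" "\<And>s. s \<in> {0..\<tau>} \<Longrightarrow> q s \<in> S"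
    and "\<And>s. s \<in> {0..\<tau>} \<Longrightarrow> (p has_vector_derivative v (p s)) (at s within {0..\<tau>})"
    and "\<And>s. s \<in> {0..\<tau>} \<Longrightarrow> (q has_vector_derivative v (q s)) (at s within {0..\<tau>})"
    and "s \<in> {0..\<tau>}"
  shows "norm (p s - q s) \<le> exp (B * s) * norm (p 0 - q 0)"
  by (rule gronwall_norm[where w = "\<lambda>s. p s - q s" and w' = "\<lambda>s. v (p s) - v (q s)" and T = \<tau>])
    (use assms in \<open>auto intro!: has_vector_derivative_diff v_lipschitz\<close>)

lemma flow_lipschitz:
  assumes "x \<in> S" "z \<in> S" "s \<in> {0..T}"
  shows "norm (\<phi> z s - \<phi> x s) \<le> exp (B * T) * norm (z - x)"
proof -
  have "norm (\<phi> z s - \<phi> x s) \<le> exp (B * s) * norm (\<phi> z 0 - \<phi> x 0)"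
    by (rule solutions_lipschitz[where \<tau> = T]) (use assms flow_in flow_deriv in auto)
  also have "\<dots> \<le> exp (B * T) * norm (z - x)"
    using assms B(1) by (auto simp: flow_0 intro!: mult_right_mono)
  finally show ?thesis .
qed

text \<open>By uniqueness: the time-shifted trajectory and the trajectory restarted at
  \<open>\<phi> x a\<close> solve the same equation with the same initial value.\<close>

lemma flow_add:
  assumes x: "x \<in> S" and "0 \<le> a" "0 \<le> b" "a + b \<le> T"
  shows "\<phi> x (a + b) = \<phi> (\<phi> x a) b"
proof -
  have a: "\<phi> x a \<in> S" using assms flow_in by simp
  have "norm (\<phi> x (a + b) - \<phi> (\<phi> x a) b) \<le> exp (B * b) * norm (\<phi> x (a + 0) - \<phi> (\<phi> x a) 0)"
  proof (rule solutions_lipschitz[where \<tau> = b and p = "\<lambda>s. \<phi> x (a + s)"])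
    fix s assume s: "s \<in> {0..b}"
    then have as: "a + s \<in> {0..T}" and sT: "s \<in> {0..T}" using assms by auto
    show "\<phi> x (a + s) \<in> S" "\<phi> (\<phi> x a) s \<in> S"
      using flow_in x as a sT by auto
    show "(\<phi> (\<phi> x a) has_vector_derivative v (\<phi> (\<phi> x a) s)) (at s within {0..b})"
      using flow_deriv[OF a sT] assms by (auto intro: has_vector_derivative_within_subset)
    have "(\<phi> x has_vector_derivative v (\<phi> x (a + s))) (at (a + s) within (+) a ` {0..b})"
      using flow_deriv[OF x as] by (rule has_vector_derivative_within_subset) (use assms in auto)
    moreover have "((+) a has_vector_derivative 1) (at s within {0..b})"
      by (auto intro!: derivative_eq_intros)
    ultimately have "(\<phi> x \<circ> (+) a has_vector_derivative 1 *\<^sub>R v (\<phi> x (a + s))) (at s within {0..b})"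
      by (intro vector_diff_chain_within)
    then show "((\<lambda>s. \<phi> x (a + s)) has_vector_derivative v (\<phi> x (a + s))) (at s within {0..b})"
      by (simp add: o_def)
  qed (use assms in auto)
  then show ?thesis by (simp add: flow_0[OF a])
qed

text \<open>Near the end of the horizon \<open>s + r\<close> may exceed \<open>T\<close>, so the flow over time \<open>s\<close> is split
  into two halves, each of which can be interchanged with the flow over time \<open>r\<close>.\<close>

lemma flow_commute:
  assumes x: "x \<in> S" and s: "s \<in> {0..T}" and r: "r \<in> {0..T/2}"
  shows "\<phi> (\<phi> x r) s = \<phi> (\<phi> x s) r"
proof -
  have r': "r \<in> {0..T}" using r T by auto
  \<comment> \<open>Either order of composition takes total time \<open>s/2 + r\<close>, which is at
    most \<open>T\<close> because \<open>r\<close> is at most \<open>T/2\<close>.\<close>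
  have half: "\<phi> (\<phi> z r) (s/2) = \<phi> (\<phi> z (s/2)) r" if "z \<in> S" for z
    using flow_add[OF that, of r "s/2"] flow_add[OF that, of "s/2" r] s r by (simp add: add.commute)
  have split: "\<phi> z s = \<phi> (\<phi> z (s/2)) (s/2)" if "z \<in> S" for z
    using flow_add[OF that, of "s/2" "s/2"] s by simp
  have "s/2 \<in> {0..T}" using s by auto
  then show ?thesis
    using half split x flow_in r' by metis
qed

text \<open>Uniform continuity of \<open>A\<close> gives a radius independent of the base point,
  which later moves along a trajectory. The estimate is the mean value inequality on the convex set
  \<open>S \<inter> ball x \<delta>\<close>.\<close>

lemma v_uniform_linearization:
  assumes "\<eta> > 0"
  obtains \<delta> where "\<delta> > 0"
    and "\<And>x y. x \<in> S \<Longrightarrow> y \<in> S \<Longrightarrow> norm (y - x) < \<delta> \<Longrightarrow>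
      norm (v y - v x - A x (y - x)) \<le> \<eta> * norm (y - x)"
proof -
  have "uniformly_continuous_on S A"
    by (rule compact_uniformly_continuous[OF A_cont compact])
  then obtain \<delta> where \<delta>: "\<delta> > 0" "\<And>x y. x \<in> S \<Longrightarrow> y \<in> S \<Longrightarrow> dist y x < \<delta> \<Longrightarrow> dist (A y) (A x) < \<eta>"
    using assms unfolding uniformly_continuous_on_def by meson
  show thesis
  proof
    show "\<delta> > 0" by fact
    fix x y assume xy: "x \<in> S" "y \<in> S" "norm (y - x) < \<delta>"
    have "norm (v y - v x - A x (y - x)) \<le> norm (y - x) * \<eta>"
    proof (rule differentiable_bound_linearization
          [where S = "S \<inter> ball x \<delta>" and f' = "\<lambda>x. blinfun_apply (A x)" and ?x0.0 = x])
      fix t :: real assume "t \<in> {0..1}"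
      moreover have "convex (S \<inter> ball x \<delta>)" using convex by (intro convex_Int) auto
      moreover have "x \<in> S \<inter> ball x \<delta>" "y \<in> S \<inter> ball x \<delta>"
        using xy \<delta>(1) by (auto simp: dist_norm norm_minus_commute)
      ultimately have "(1 - t) *\<^sub>R x + t *\<^sub>R y \<in> S \<inter> ball x \<delta>"
        by (auto simp: convex_alt)
      then show "x + t *\<^sub>R (y - x) \<in> S \<inter> ball x \<delta>" by (simp add: algebra_simps)
    next
      fix z assume z: "z \<in> S \<inter> ball x \<delta>"
      then show "(v has_derivative A z) (at z within S \<inter> ball x \<delta>)"
        using v_deriv by (blast intro: has_derivative_subset)
      have "onorm (A z - A x) = norm (A z - A x)" by (simp add: norm_blinfun.rep_eq)
      moreover have "blinfun_apply (A z - A x) = blinfun_apply (A z) - blinfun_apply (A x)"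
        by (auto simp: blinfun.diff_left)
      ultimately show "onorm (blinfun_apply (A z) - blinfun_apply (A x)) \<le> \<eta>"
        using \<delta>(2)[of x z] z xy by (simp add: dist_norm norm_minus_commute)
    qed (use xy \<delta>(1) in auto)
    then show "norm (v y - v x - A x (y - x)) \<le> \<eta> * norm (y - x)" by (simp add: mult.commute)
  qed
qed

text \<open>The error starts at zero and solves the variational equation up to a forcing term of
  norm at most \<open>c\<close>, so it stays within a constant multiple of \<open>c\<close>.\<close>

lemma flow_linearization_error:
  assumes x: "x \<in> S" and z: "z \<in> S" and c: "c \<ge> 0"
    and M0: "M 0 = id_blinfun"
    and M: "\<And>s. s \<in> {0..T} \<Longrightarrow> (M has_vector_derivative A (\<phi> x s) o\<^sub>L M s) (at s within {0..T})"
    and err: "\<And>s. s \<in> {0..T} \<Longrightarrow>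
      norm (v (\<phi> z s) - v (\<phi> x s) - A (\<phi> x s) (\<phi> z s - \<phi> x s)) \<le> c"
    and s: "s \<in> {0..T}"
  shows "norm (\<phi> z s - \<phi> x s - M s (z - x)) \<le> exp ((B + 1) * T) * c"
proof -
  define e where "e s = \<phi> z s - \<phi> x s - M s (z - x)" for s
  define e' where "e' s = v (\<phi> z s) - v (\<phi> x s) - A (\<phi> x s) (M s (z - x))" for s
  have e_deriv: "(e has_vector_derivative e' s) (at s within {0..T})" if "s \<in> {0..T}" for s
    unfolding e_def e'_def
    using bounded_linear.has_vector_derivative[OF blinfun.bounded_linear_left[of "z - x"] M[OF that]]
    by (intro has_vector_derivative_diff flow_deriv x z that) simp
  have e_bound: "norm (e' s) \<le> c + B * norm (e s)" if "s \<in> {0..T}" for s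
  proof -
    have "e' s = (v (\<phi> z s) - v (\<phi> x s) - A (\<phi> x s) (\<phi> z s - \<phi> x s)) + A (\<phi> x s) (e s)"
      by (simp add: e_def e'_def blinfun.bilinear_simps)
    also have "norm \<dots> \<le> c + norm (A (\<phi> x s)) * norm (e s)"
      by (rule norm_triangle_mono[OF err[OF that] norm_blinfun])
    also have "\<dots> \<le> c + B * norm (e s)"
      using B(2)[OF flow_in[OF x that]] by (simp add: mult_right_mono)
    finally show ?thesis .
  qed
  \<comment> \<open>Pairing the error with the constant \<open>c\<close> makes the inhomogeneous estimate homogeneous.\<close>
  have "norm (e s, c) \<le> exp ((B + 1) * s) * norm (e 0, c)"
  proof (rule gronwall_norm[where T = T and w = "\<lambda>s. (e s, c)" and w' = "\<lambda>s. (e' s, 0)"])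
    fix s assume s: "s \<in> {0..T}"
    show "((\<lambda>s. (e s, c)) has_vector_derivative (e' s, 0)) (at s within {0..T})"
      by (intro has_vector_derivative_Pair e_deriv s has_vector_derivative_const)
    have "norm (e s) \<le> norm (e s, c)" "c \<le> norm (e s, c)"
      using norm_fst_le[of "e s" c] norm_snd_le[of c "e s"] c by auto
    then have "c + B * norm (e s) \<le> norm (e s, c) + B * norm (e s, c)"
      using B(1) by (intro add_mono mult_left_mono) auto
    then show "norm (e' s, 0::real) \<le> (B + 1) * norm (e s, c)"
      using e_bound[OF s] by (simp add: norm_Pair algebra_simps)
  qed (fact s)
  also have "\<dots> = exp ((B + 1) * s) * c"
    using c by (simp add: e_def flow_0 x z M0 norm_Pair)
  also have "\<dots> \<le> exp ((B + 1) * T) * c"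
    using s B(1) c by (auto intro!: mult_right_mono)
  finally show ?thesis
    using norm_fst_le[of "e s" c] by (simp add: e_def)
qed

text \<open>The derivative is the solution \<open>M s\<close> of the variational equation.
  Trajectories separate at most linearly in \<open>norm (z - x)\<close>, so the linearization
  remainder of \<open>v\<close> along them is small relative to \<open>norm (z - x)\<close>,
  uniformly in time.\<close>

lemma flow_differentiable:
  assumes x: "x \<in> S" and s: "s \<in> {0..T}"
  shows "(\<lambda>z. \<phi> z s) differentiable (at x within S)"
proof -
  have "continuous_on {0..T} (\<lambda>s. A (\<phi> x s))"
    by (rule continuous_on_compose2[OF A_cont
          has_derivative_continuous_on[OF flow_deriv[OF x, unfolded has_vector_derivative_def]]])
      (use flow_in x in auto)
  then obtain M where M0: "M 0 = id_blinfun"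
    and M: "\<And>s. s \<in> {0..T} \<Longrightarrow> (M has_vector_derivative A (\<phi> x s) o\<^sub>L M s) (at s within {0..T})"
    using linear_ode_solution_exists[OF _ T] by blast
  \<comment> \<open>Product of the amplification of the forcing term and the Lipschitz constant of
    the flow; tolerance \<epsilon> divided by \<open>C\<close> then ends as exactly
    \<epsilon>.\<close>
  define C where "C = exp ((B + 1) * T) * exp (B * T)"
  have C: "C > 0" by (simp add: C_def)
  have "((\<lambda>z. \<phi> z s) has_derivative M s) (at x within S)"
    unfolding has_derivative_within_alt
  proof (intro conjI allI impI blinfun.bounded_linear_right)
    fix \<epsilon> :: real assume \<epsilon>: "\<epsilon> > 0"
    then have "\<epsilon> / C > 0" using C by simp
    then obtain \<delta> where \<delta>: "\<delta> > 0" "\<And>x y. x \<in> S \<Longrightarrow> y \<in> S \<Longrightarrow> norm (y - x) < \<delta> \<Longrightarrow>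
      norm (v y - v x - A x (y - x)) \<le> \<epsilon> / C * norm (y - x)"
      using v_uniform_linearization by metis
    show "\<exists>d>0. \<forall>z\<in>S. norm (z - x) < d \<longrightarrow> norm (\<phi> z s - \<phi> x s - M s (z - x)) \<le> \<epsilon> * norm (z - x)"
    \<comment> \<open>This radius keeps the two trajectories closer than \<delta> on all of
      \<open>{0..T}\<close>.\<close>
    proof (intro exI[of _ "\<delta> / exp (B * T)"] conjI ballI impI)
      show "\<delta> / exp (B * T) > 0" using \<delta>(1) by simp
      fix z assume z: "z \<in> S" and near: "norm (z - x) < \<delta> / exp (B * T)"
      have "norm (\<phi> z s - \<phi> x s - M s (z - x))
          \<le> exp ((B + 1) * T) * (\<epsilon> / C * (exp (B * T) * norm (z - x)))"
      proof (rule flow_linearization_error[OF x z _ M0 M _ s])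
        show "0 \<le> \<epsilon> / C * (exp (B * T) * norm (z - x))" using \<epsilon> C by simp
        fix r assume r: "r \<in> {0..T}"
        have lip: "norm (\<phi> z r - \<phi> x r) \<le> exp (B * T) * norm (z - x)"
          by (rule flow_lipschitz[OF x z r])
        also have "\<dots> < \<delta>" using near by (simp add: field_simps)
        finally have "norm (v (\<phi> z r) - v (\<phi> x r) - A (\<phi> x r) (\<phi> z r - \<phi> x r))
            \<le> \<epsilon> / C * norm (\<phi> z r - \<phi> x r)"
          by (intro \<delta>(2) flow_in x z r)
        also have "\<dots> \<le> \<epsilon> / C * (exp (B * T) * norm (z - x))"
          using lip \<epsilon> C by (intro mult_left_mono) auto
        finally show "norm (v (\<phi> z r) - v (\<phi> x r) - A (\<phi> x r) (\<phi> z r - \<phi> x r))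
            \<le> \<epsilon> / C * (exp (B * T) * norm (z - x))" .
      qed
      also have "\<dots> = \<epsilon> * norm (z - x)" by (simp add: C_def)
      finally show "norm (\<phi> z s - \<phi> x s - M s (z - x)) \<le> \<epsilon> * norm (z - x)" .
    qed
  qed
  then show ?thesis unfolding differentiable_def by blast
qed

text \<open>Both sides are the one-sided derivative at \<open>r = 0\<close> of \<open>\<phi> (\<phi> x r) s = \<phi> (\<phi> x s) r\<close>. This
  holds for every derivative relative to \<open>S\<close>, even where that derivative is not unique.\<close>

lemma flow_derivative_field:
  assumes x: "x \<in> S" and s: "s \<in> {0..T}"
    and D: "((\<lambda>z. \<phi> z s) has_derivative D) (at x within S)"
  shows "D (v x) = v (\<phi> x s)"
proof -
  let ?I = "{0..T/2}"
  have I: "?I \<subseteq> {0..T}" and 0: "0 \<in> {0..T}" "0 \<in> ?I" using T by auto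
  have dx: "(\<phi> z has_vector_derivative v z) (at 0 within ?I)" if "z \<in> S" for z
    using has_vector_derivative_within_subset[OF flow_deriv[OF that 0(1)] I]
    by (simp add: flow_0[OF that])
  \<comment> \<open>The chain rule needs the derivative only along the trajectory, which stays in
    \<open>S\<close>.\<close>
  have "((\<lambda>z. \<phi> z s) has_derivative D) (at (\<phi> x 0) within \<phi> x ` ?I)"
    using D x I flow_in by (auto simp: flow_0 intro: has_derivative_subset)
  from vector_derivative_diff_chain_within[OF dx[OF x] this]
  have "((\<lambda>r. \<phi> (\<phi> x r) s) has_vector_derivative D (v x)) (at 0 within ?I)"
    by (simp add: o_def)
  then have "(\<phi> (\<phi> x s) has_vector_derivative D (v x)) (at 0 within ?I)"
    by (rule has_vector_derivative_transform[OF 0(2), rotated]) (use flow_commute[OF x s] in auto)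
  moreover have "(\<phi> (\<phi> x s) has_vector_derivative v (\<phi> x s)) (at 0 within ?I)"
    by (rule dx[OF flow_in[OF x s]])
  ultimately show ?thesis
    using vector_derivative_unique_within_closed_interval[of 0 "T/2" 0] T by auto
qed

end

section \<open>Regularity of the backup field and the sensitivity identity\<close>

lemma C1_on_derivative_within:
  assumes "C1_on f S"
  obtains f' :: "'a::real_normed_vector \<Rightarrow> 'a \<Rightarrow>\<^sub>L 'b::real_normed_vector"
  where "\<And>x. x \<in> S \<Longrightarrow> (f has_derivative f' x) (at x within S)" "continuous_on S f'"
proof -
  obtain V F and F' :: "'a \<Rightarrow> 'a \<Rightarrow>\<^sub>L 'b" where V: "S \<subseteq> V" "\<forall>x\<in>S. F x = f x"
    "\<forall>x\<in>V. (F has_derivative F' x) (at x)" "continuous_on V F'"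
    using assms unfolding C1_on_def by blast
  show thesis
  proof
    show "continuous_on S F'" using V by (blast intro: continuous_on_subset)
    fix x assume x: "x \<in> S"
    then have "(F has_derivative F' x) (at x within S)"
      using V by (blast intro: has_derivative_at_withinI)
    then show "(f has_derivative F' x) (at x within S)"
      by (rule has_derivative_transform[OF x, rotated]) (use V in auto)
  qed
qed

lemma bounded_bilinear_matrix_vector_mult:
  "bounded_bilinear ((*v) :: real^'m^'n \<Rightarrow> real^'m \<Rightarrow> real^'n)"
  by (rule bilinear_conv_bounded_bilinear[THEN iffD1])
    (auto simp: bilinear_def linear_iff matrix_vector_mult_add_rdistrib matrix_vector_right_distrib
      matrix_vector_mult_scaleR scaleR_matrix_vector_assoc)

lemma backup_field_derivative_within:
  fixes D :: "('n::finite, 'm::finite, 'd::finite) ocbf"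
  assumes "C1_on (drift D) (states D)" "C1_on (actuation D) (states D)" "C1_on (policy D k) (states D)"
  obtains A :: "real^'n \<Rightarrow> (real^'n) \<Rightarrow>\<^sub>L (real^'n)"
  where "\<And>x. x \<in> states D \<Longrightarrow> (backup_field D k has_derivative A x) (at x within states D)"
    "continuous_on (states D) A"
proof -
  let ?S = "states D"
  interpret mv: bounded_bilinear "(*v) :: real^'m^'n \<Rightarrow> real^'m \<Rightarrow> real^'n"
    by (rule bounded_bilinear_matrix_vector_mult)
  obtain f' where f': "\<And>x. x \<in> ?S \<Longrightarrow> (drift D has_derivative blinfun_apply (f' x)) (at x within ?S)"
    "continuous_on ?S f'"
    using C1_on_derivative_within[OF assms(1)] by blast
  obtain g' where g': "\<And>x. x \<in> ?S \<Longrightarrow> (actuation D has_derivative blinfun_apply (g' x)) (at x within ?S)"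
    "continuous_on ?S g'"
    using C1_on_derivative_within[OF assms(2)] by blast
  obtain p' where p': "\<And>x. x \<in> ?S \<Longrightarrow> (policy D k has_derivative blinfun_apply (p' x)) (at x within ?S)"
    "continuous_on ?S p'"
    using C1_on_derivative_within[OF assms(3)] by blast
  have cont: "continuous_on ?S (actuation D)" "continuous_on ?S (policy D k)"
    by (rule has_derivative_continuous_on, fact g' p')+
  \<comment> \<open>Product rule for \<open>backup_field\<close>.\<close>
  define L where "L x w = f' x w + (actuation D x *v p' x w + g' x w *v policy D k x)" for x w
  have L: "(backup_field D k has_derivative L x) (at x within ?S)" if "x \<in> ?S" for x
    unfolding backup_field_def L_def
    by (intro has_derivative_add f' mv.FDERIV g' p' that)
  show thesis
  proof
    \<comment> \<open>\<open>Blinfun\<close> returns its argument only for bounded linear maps,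
      which \<open>L x\<close> is known to be on the state set.\<close>
    have eq: "blinfun_apply (Blinfun (L x)) = L x" if "x \<in> ?S" for x
      using L[OF that] by (simp add: bounded_linear_Blinfun_apply has_derivative_bounded_linear)
    show "(backup_field D k has_derivative Blinfun (L x)) (at x within ?S)" if "x \<in> ?S" for x
      using L[OF that] eq[OF that] by simp
    show "continuous_on ?S (\<lambda>x. Blinfun (L x))"
    \<comment> \<open>In finite dimension, continuity in operator norm reduces to continuity at each
      fixed argument.\<close>
    proof (rule continuous_on_blinfun_componentwise)
      fix i :: "real^'n"
      have "continuous_on ?S (\<lambda>x. L x i)"
        unfolding L_def by (intro continuous_intros mv.continuous_on cont f' g' p')
      then show "continuous_on ?S (\<lambda>x. blinfun_apply (Blinfun (L x)) i)"
        by (rule continuous_on_eq) (simp add: eq)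
    qed
  qed
qed

text \<open>\<open>sensitivity\<close> is the matrix of a chosen derivative. Differentiability of
  the flow makes the choice a genuine derivative, and the semiflow identity holds for every such
  choice.\<close>

lemma sensitivity_backup_field:
  fixes D :: "('n::finite, 'm::finite, 'd::finite) ocbf"
  assumes "compact (states D)" "convex (states D)" "horizon D > 0"
    and "C1_on (drift D) (states D)" "C1_on (actuation D) (states D)" "C1_on (policy D k) (states D)"
    and flow: "is_backup_flow D k"
    and x: "x \<in> states D" and s: "s \<in> {0..horizon D}"
  shows "sensitivity D k x s *v backup_field D k x = backup_field D k (flow D k x s)"
proof -
  obtain A where A: "\<And>x. x \<in> states D \<Longrightarrow>
      (backup_field D k has_derivative blinfun_apply (A x)) (at x within states D)"
    "continuous_on (states D) A"
    using backup_field_derivative_within[OF assms(4-6)] by blast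
  interpret compact_semiflow "states D" "backup_field D k" A "flow D k" "horizon D"
    by unfold_locales (use assms A flow in \<open>auto simp: is_backup_flow_def\<close>)
  have deriv: "((\<lambda>z. flow D k z s) has_derivative
      frechet_derivative (\<lambda>z. flow D k z s) (at x within states D)) (at x within states D)"
    using flow_differentiable[OF x s] by (simp add: frechet_derivative_works)
  then have "linear (frechet_derivative (\<lambda>z. flow D k z s) (at x within states D))"
    by (rule has_derivative_linear)
  then show ?thesis
    using flow_derivative_field[OF x s deriv]
    by (simp add: sensitivity_def jacobian_within_def matrix_works)
qed

section \<open>The constraints at the backup input\<close>

theorem lemma1:
  fixes D :: "('n::finite, 'm::finite, 'd::finite) ocbf"
    and \<alpha>\<^sub>S :: "real \<Rightarrow> real"
  assumes setting: "ocbf_setting D"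
    and coverage: "\<And>k t s j. t \<in> upd_interval D k \<Longrightarrow> s \<in> {0..horizon D} \<Longrightarrow> j \<in> {1..regions D k} \<Longrightarrow>
        occ D j (position D (traj D t)) t + cball 0 (obs_speed D * s + col_radius D)
          \<subseteq> pred_occ D j t s"
    and consistency: "\<And>k t s j \<delta>. \<delta> \<ge> 0 \<Longrightarrow> j \<in> {1..regions D k} \<Longrightarrow>
        t \<in> upd_interval D k \<Longrightarrow> t + \<delta> \<in> upd_interval D k \<Longrightarrow>
        s \<in> {0..horizon D} \<Longrightarrow> s + \<delta> \<in> {0..horizon D} \<Longrightarrow>
        pred_occ D j (t + \<delta>) s \<subseteq> pred_occ D j t (s + \<delta>)"
    and alpha_S: "ext_class_K \<alpha>\<^sub>S"
    and terminal: "\<And>k q y j. q \<in> shifted_interval D k \<Longrightarrow> y \<in> terminal_set D k q \<Longrightarrow>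
        j \<in> {1..regions D k} \<Longrightarrow>
        barrier_dq D k j y q + barrier_dy D j y q \<bullet> backup_field D k y \<ge> - \<alpha>\<^sub>S (barrier D j y q)"
    and monotone: "\<And>k y t s j. y \<in> states D \<Longrightarrow> t \<in> upd_interval D k \<Longrightarrow> s \<in> {0..horizon D} \<Longrightarrow>
        j \<in> {1..regions D k} \<Longrightarrow> margin_dt D k j y t s - margin_ds D j y t s \<ge> 0"
    and C1_robot: "C1_on (drift D) (states D)" "C1_on (actuation D) (states D)"
        "C1_on (position D) (states D)"
    and C1_policy: "\<And>k. C1_on (policy D k) (states D)"
    and C1_margin: "\<And>k j. j \<in> {1..regions D k} \<Longrightarrow>
        C1_on (\<lambda>(y, t, s). margin D j y t s) (states D \<times> upd_interval D k \<times> {0..horizon D})"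
    and C1_barrier: "\<And>k j. j \<in> {1..regions D k} \<Longrightarrow>
        C1_on (\<lambda>(y, q). barrier D j y q) (states D \<times> shifted_interval D k)"
    and policy_inputs: "\<And>k x. x \<in> states D \<Longrightarrow> policy D k x \<in> inputs D"
    and flow: "\<And>k. is_backup_flow D k"
  shows "(\<forall>k. \<forall>t\<in>upd_interval D k. \<forall>x\<in>recoverable_set D k t.
            satisfies_constraints (policy D k x) (ocbf_qp D \<alpha>\<^sub>S k x t)) \<and>
         (\<forall>k. \<forall>t\<in>upd_interval D k. \<forall>x\<in>recoverable_set D k t.
            feasible (ocbf_qp D \<alpha>\<^sub>S k x t))"
proof -
  have "satisfies_constraints (policy D k x) (ocbf_qp D \<alpha>\<^sub>S k x t)"
    if t: "t \<in> upd_interval D k" and rec: "x \<in> recoverable_set D k t" for k t x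
  proof -
    let ?T = "horizon D" and ?u = "policy D k x"
    have x: "x \<in> states D" using rec by (simp add: recoverable_set_def)
    have T: "?T > 0" and alpha_C: "ext_class_K (alpha_C D)"
      using setting by (simp_all add: ocbf_setting_def)
    have flow_in: "flow D k x s \<in> states D" if "s \<in> {0..?T}" for s
      using flow[of k] x that by (simp add: is_backup_flow_def)
    \<comment> \<open>The drift and input terms of both constraints combine into the sensitivity
      applied to \<open>backup_field D k x\<close>.\<close>
    have sens: "sensitivity D k x s *v drift D x + (sensitivity D k x s ** actuation D x) *v ?u
        = backup_field D k (flow D k x s)" if "s \<in> {0..?T}" for s
    proof -
      have "sensitivity D k x s *v backup_field D k x = backup_field D k (flow D k x s)"
        by (rule sensitivity_backup_field)
          (use setting C1_robot C1_policy flow x that in \<open>auto simp: ocbf_setting_def\<close>)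
      then show ?thesis
        by (simp add: backup_field_def matrix_vector_right_distrib matrix_vector_mul_assoc)
    qed
    have "c_C D k j x t s + A_C D k j x t s \<bullet> ?u \<ge> - alpha_C D (margin D j (flow D k x s) t s)"
      if j: "j \<in> {1..regions D k}" and s: "s \<in> {0..?T}" for j s
    proof -
      let ?y = "flow D k x s"
      have "c_C D k j x t s + A_C D k j x t s \<bullet> ?u
          = margin_dy D j ?y t s \<bullet> (sensitivity D k x s *v drift D x
              + (sensitivity D k x s ** actuation D x) *v ?u - backup_field D k ?y)
            + margin_dt D k j ?y t s - margin_ds D j ?y t s"
        by (simp add: c_C_def A_C_def Let_def dot_lmul_matrix algebra_simps inner_add_right
            inner_diff_right)
      \<comment> \<open>The gradient is paired with the zero vector, so its choice does not
        matter.\<close>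
      also have "\<dots> = margin_dt D k j ?y t s - margin_ds D j ?y t s"
        by (simp add: sens[OF s])
      also have "\<dots> \<ge> 0"
        by (rule monotone[OF flow_in[OF s] t s j])
      finally have "c_C D k j x t s + A_C D k j x t s \<bullet> ?u \<ge> 0" .
      moreover have "margin D j ?y t s \<ge> 0"
        using rec j s by (simp add: recoverable_set_def)
      \<comment> \<open>Since \<open>alpha_C D 0 = 0\<close>, the required lower bound is
        nonpositive.\<close>
      then have "alpha_C D (margin D j ?y t s) \<ge> alpha_C D 0"
        using alpha_C unfolding ext_class_K_def by (metis strict_mono_less_eq)
      ultimately show ?thesis using alpha_C by (simp add: ext_class_K_def)
    qed
    moreover have "c_S D k j x t + A_S D k j x t \<bullet> ?u \<ge> - \<alpha>\<^sub>S (terminal_value D k j x t)"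
      if j: "j \<in> {1..regions D k}" for j
    proof -
      let ?y = "flow D k x ?T" and ?q = "t + ?T"
      have q: "?q \<in> shifted_interval D k" using t by (simp add: shifted_interval_def)
      \<comment> \<open>The terminal condition applies at the endpoint of the backup trajectory,
        where recoverability makes all barriers nonnegative at once.\<close>
      have y: "?y \<in> terminal_set D k ?q"
        using rec flow_in[of ?T] T by (auto simp: terminal_set_def recoverable_set_def terminal_value_def)
      have "c_S D k j x t + A_S D k j x t \<bullet> ?u
          = barrier_dq D k j ?y ?q + barrier_dy D j ?y ?q \<bullet> (sensitivity D k x ?T *v drift D x
              + (sensitivity D k x ?T ** actuation D x) *v ?u)"
        by (simp add: c_S_def A_S_def Let_def dot_lmul_matrix inner_add_right)
      also have "\<dots> = barrier_dq D k j ?y ?q + barrier_dy D j ?y ?q \<bullet> backup_field D k ?y"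
        using T by (simp add: sens)
      finally show ?thesis
        using terminal[OF q y j] by (simp add: terminal_value_def)
    qed
    ultimately show ?thesis
      using policy_inputs[OF x, of k]
      by (auto simp: satisfies_constraints_def ocbf_qp_def qp_feasible_set_def)
  qed
  then show ?thesis by (auto simp: feasible_def)
qed

end
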